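(* Any critical point $w\in D(\Psi+J)$ of the energy functional $\mathcal{E}=\Psi+J+\mathbf{F}:X_{T+2}\to(-\infty,+\infty]$ is a solution of the problem $$\begin{cases}-\Delta[\phi(\Delta u(n-1))]=\nabla_u F(n,u(n)) & (n\in\mathbb{Z}[1,T]),\\ (\phi(\Delta u(0)),-\phi(\Delta u(T)))\in\partial j(u(0),u(T+1)).\end{cases}$$
   Context: $N\ge 1$ and $T\ge 2$ are fixed integers and $a>0$ is fixed. $\langle\cdot|\cdot\rangle$ and $|\cdot|$ are the Euclidean inner product and norm on $\mathbb{R}^N$, and $\mathbb{R}^N\times\mathbb{R}^N$ carries its usual inner product. $B_a=\{x\in\mathbb{R}^N:|x|<a\}$. $\mathbb{Z}[p,q]=\{p,\dots,q\}$. $X_{T+2}=\{u:\mathbb{Z}[0,T+1]\to\mathbb{R}^N\}$. $\Delta u(n-1)=u(n)-u(n-1)$, $\Delta[\phi(\Delta u(n-1))]=\phi(\Delta u(n))-\phi(\Delta u(n-1))$, $\|\Delta u\|_\infty=\max_{n\in\mathbb{Z}[1,T+1]}|\Delta u(n-1)|$. Assumptions. (1) $\phi: B_a\to\mathbb{R}^N$ is a homeomorphism from $B_a$ onto $\mathbb{R}^N$ with $\phi(0)=0$ and $\phi=\nabla\Phi$ on $B_a$, where $\Phi:\overline{B}_a\to\mathbb{R}$ is of class $C^1$ on $B_a$, continuous and strictly convex on $\overline{B}_a$, $\Phi(0)=0$. (2) $F=F(n,u):\mathbb{Z}[1,T]\times\mathbb{R}^N\to\mathbb{R}$ is continuous,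 $\nabla_uF$ exists and is continuous on $\mathbb{Z}[1,T]\times\mathbb{R}^N$, and $F(\cdot,0)=0$. (3) $j:\mathbb{R}^N\times\mathbb{R}^N\to(-\infty,+\infty]$ is proper, convex, lower semicontinuous, $j(0,0)=0$ and $(0,0)\in\partial j(0,0)$, where $\partial j$ is the subdifferential in the sense of convex analysis. Functionals on $X_{T+2}$: $\Psi(u)=\sum_{n=1}^{T+1}\Phi[\Delta u(n-1)]$ if $\|\Delta u\|_\infty\le a$ and $\Psi(u)=+\infty$ otherwise; $J(u)=j(u(0),u(T+1))$; $\mathbf{F}(u)=-\sum_{n=1}^TF(n,u(n))$, which is of class $C^1$ with $\langle\mathbf{F}'(u),v\rangle=-\sum_{n=1}^T\langle\nabla_uF(n,u(n))|v(n)\rangle$. $D(\cdot)$ denotes the effective domain, so $D(\Psi+J)=\{u\in X_{T+2}:\|\Delta u\|_\infty\le a,\ j(u(0),u(T+1))<+\infty\}$. A critical point of $\mathcal{E}$ is an element $w\in D(\Psi+J)$ such that $(\Psi+J)(v)-(\Psi+J)(w)+\langle\mathbf{F}'(w),v-w\rangle\ge0$ for all $v\in D(\Psi+J)$. A solution of the problem is a function $u\in X_{T+2}$ with $\|\Delta u\|_\infty<a$ and $\partial j(u(0),u(T+1))\ne\emptyset$ that satisfies both the equations and the boundary condition. *)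

theory Defs
  imports "HOL-Analysis.Analysis"
begin

section \<open>Gradients and convex analysis\<close>

definition gradient :: "('a::real_inner \<Rightarrow> real) \<Rightarrow> 'a \<Rightarrow> 'a" where
  "gradient f x = (THE D. GDERIV f x :> D)"

lemma gradient_eqI:
  assumes "GDERIV f x :> D"
  shows "gradient f x = D"
  unfolding gradient_def
proof (rule the_equality)
  fix D' assume "GDERIV f x :> D'"
  with assms have "(\<lambda>h. h \<bullet> D') = (\<lambda>h. h \<bullet> D)"
    unfolding gderiv_def by (rule has_derivative_unique[rotated])
  then have "(D' - D) \<bullet> (D' - D) = 0"
    by (metis inner_diff_right right_minus_eq)
  then show "D' = D" by simp
qed (fact assms)

definition C1_on :: "'a::real_inner set \<Rightarrow> ('a \<Rightarrow> real) \<Rightarrow> bool" where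
  "C1_on S f \<longleftrightarrow> (\<forall>x\<in>S. \<exists>D. GDERIV f x :> D) \<and> continuous_on S (gradient f)"

definition strictly_convex_on :: "'a::real_vector set \<Rightarrow> ('a \<Rightarrow> real) \<Rightarrow> bool" where
  "strictly_convex_on S f \<longleftrightarrow> convex S \<and>
    (\<forall>x\<in>S. \<forall>y\<in>S. \<forall>t. x \<noteq> y \<longrightarrow> 0 < t \<longrightarrow> t < 1 \<longrightarrow>
      f ((1 - t) *\<^sub>R x + t *\<^sub>R y) < (1 - t) * f x + t * f y)"

text \<open>Functions with values in $(-\infty,+\infty]$ are \<open>ereal\<close>-valued functions omitting \<open>-\<infinity>\<close>;
  the latter is part of properness.\<close>

definition proper_fun :: "('a \<Rightarrow> ereal) \<Rightarrow> bool" where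
  "proper_fun f \<longleftrightarrow> (\<forall>x. f x \<noteq> -\<infinity>) \<and> (\<exists>x. f x < \<infinity>)"

definition convex_fun :: "('a::real_vector \<Rightarrow> ereal) \<Rightarrow> bool" where
  "convex_fun f \<longleftrightarrow> (\<forall>x y t. 0 < t \<longrightarrow> t < 1 \<longrightarrow>
      f ((1 - t) *\<^sub>R x + t *\<^sub>R y) \<le> ereal (1 - t) * f x + ereal t * f y)"

definition lsc_fun :: "('a::topological_space \<Rightarrow> ereal) \<Rightarrow> bool" where
  "lsc_fun f \<longleftrightarrow> (\<forall>x. f x \<le> Liminf (at x) f)"

text \<open>The subgradient inequality is written with the difference moved to the other side, so that
  no \<open>\<infinity> - \<infinity>\<close> arises. For proper \<open>f\<close> the subdifferential is empty where \<open>f = \<infinity>\<close>.\<close>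

definition subdifferential :: "('a::real_inner \<Rightarrow> ereal) \<Rightarrow> 'a \<Rightarrow> 'a set" where
  "subdifferential f x = {p. \<forall>y. f x + ereal (p \<bullet> (y - x)) \<le> f y}"


section \<open>The discrete boundary value problem\<close>

text \<open>\<open>X T\<close> is $X_{T+2}$: functions on $\{0,\dots,T+1\}$, extensional so that different
  elements differ on that index set.\<close>

definition X :: "nat \<Rightarrow> (nat \<Rightarrow> 'a) set" where
  "X T = {0..T + 1} \<rightarrow>\<^sub>E UNIV"

definition Delta :: "(nat \<Rightarrow> 'a::ab_group_add) \<Rightarrow> nat \<Rightarrow> 'a" where
  "Delta u n = u (Suc n) - u n"

definition Delta_norm :: "nat \<Rightarrow> (nat \<Rightarrow> 'a::real_normed_vector) \<Rightarrow> real" where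
  "Delta_norm T u = Max ((\<lambda>n. norm (Delta u (n - 1))) ` {1..T + 1})"

definition Psi :: "nat \<Rightarrow> real \<Rightarrow> ('a::real_normed_vector \<Rightarrow> real) \<Rightarrow> (nat \<Rightarrow> 'a) \<Rightarrow> ereal" where
  "Psi T a \<Phi> u =
    (if Delta_norm T u \<le> a then ereal (\<Sum>n = 1..T + 1. \<Phi> (Delta u (n - 1))) else \<infinity>)"

definition J :: "nat \<Rightarrow> ('a \<times> 'a \<Rightarrow> ereal) \<Rightarrow> (nat \<Rightarrow> 'a) \<Rightarrow> ereal" where
  "J T j u = j (u 0, u (T + 1))"

definition F_fun :: "nat \<Rightarrow> (nat \<Rightarrow> 'a \<Rightarrow> real) \<Rightarrow> (nat \<Rightarrow> 'a) \<Rightarrow> real" where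
  "F_fun T F u = - (\<Sum>n = 1..T. F n (u n))"

definition F_fun_deriv ::
  "nat \<Rightarrow> (nat \<Rightarrow> 'a::real_inner \<Rightarrow> real) \<Rightarrow> (nat \<Rightarrow> 'a) \<Rightarrow> (nat \<Rightarrow> 'a) \<Rightarrow> real" where
  "F_fun_deriv T F u v = - (\<Sum>n = 1..T. gradient (F n) (u n) \<bullet> v n)"

text \<open>\<open>F_fun_deriv T F u\<close> is the Frechet derivative of \<open>F_fun T F\<close> at \<open>u\<close>, for the Euclidean norm
  on $X_{T+2}$.\<close>

lemma F_fun_deriv_frechet:
  fixes F :: "nat \<Rightarrow> 'a::real_inner \<Rightarrow> real"
  assumes diff: "\<And>n. n \<in> {1..T} \<Longrightarrow> \<exists>D. GDERIV (F n) (u n) :> D" and "e > 0"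
  shows "\<exists>d>0. \<forall>v. L2_set (\<lambda>n. norm (v n)) {0..T + 1} < d \<longrightarrow>
    \<bar>F_fun T F (\<lambda>n. u n + v n) - F_fun T F u - F_fun_deriv T F u v\<bar>
      \<le> e * L2_set (\<lambda>n. norm (v n)) {0..T + 1}"
proof -
  let ?G = "\<lambda>n. gradient (F n) (u n)"
  define c where "c = e / (real T + 1)"
  have "c > 0" using \<open>e > 0\<close> by (simp add: c_def)
  have "\<exists>d>0. \<forall>h. norm h < d \<longrightarrow> \<bar>F n (u n + h) - F n (u n) - ?G n \<bullet> h\<bar> \<le> c * norm h"
    if n: "n \<in> {1..T}" for n
  proof -
    obtain D where "GDERIV (F n) (u n) :> D" using diff[OF n] by blast
    then have "(F n has_derivative (\<lambda>h. h \<bullet> ?G n)) (at (u n))"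
      by (simp add: gradient_eqI gderiv_def[symmetric])
    then obtain d where "d > 0" and
      d: "\<And>y. norm (y - u n) < d \<Longrightarrow>
            norm (F n y - F n (u n) - (y - u n) \<bullet> ?G n) \<le> c * norm (y - u n)"
      using \<open>c > 0\<close> unfolding has_derivative_at_alt by blast
    show ?thesis
    proof (intro exI conjI allI impI)
      fix h :: 'a assume "norm h < d"
      then show "\<bar>F n (u n + h) - F n (u n) - ?G n \<bullet> h\<bar> \<le> c * norm h"
        using d[of "u n + h"] by (simp add: inner_commute)
    qed (fact \<open>d > 0\<close>)
  qed
  then obtain d where d: "\<And>n. n \<in> {1..T} \<Longrightarrow> d n > 0"
      "\<And>n h. n \<in> {1..T} \<Longrightarrow> norm h < d n \<Longrightarrow>
        \<bar>F n (u n + h) - F n (u n) - ?G n \<bullet> h\<bar> \<le> c * norm h"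
    by metis
  define m where "m = Min (insert 1 (d ` {1..T}))"
  show ?thesis
  proof (intro exI conjI allI impI)
    show "m > 0" using d(1) by (auto simp: m_def)
    fix v :: "nat \<Rightarrow> 'a"
    let ?N = "L2_set (\<lambda>n. norm (v n)) {0..T + 1}"
    assume N: "?N < m"
    have le: "norm (v n) \<le> ?N" if "n \<in> {1..T}" for n
      using that member_le_L2_set[of "{0..T + 1}" n "\<lambda>n. norm (v n)"] by auto
    have bnd: "\<bar>F n (u n + v n) - F n (u n) - ?G n \<bullet> v n\<bar> \<le> c * ?N" if n: "n \<in> {1..T}" for n
    proof -
      have "m \<le> d n" unfolding m_def using n by (intro Min_le) auto
      then have "norm (v n) < d n" using le[OF n] N by linarith
      from d(2)[OF n this] show ?thesis
        using le[OF n] \<open>c > 0\<close> by (meson mult_left_mono less_imp_le order_trans)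
    qed
    have "F_fun T F (\<lambda>n. u n + v n) - F_fun T F u - F_fun_deriv T F u v =
        - (\<Sum>n = 1..T. F n (u n + v n) - F n (u n) - ?G n \<bullet> v n)"
      by (simp add: F_fun_def F_fun_deriv_def sum_subtractf)
    then have "\<bar>F_fun T F (\<lambda>n. u n + v n) - F_fun T F u - F_fun_deriv T F u v\<bar>
        \<le> (\<Sum>n = 1..T. \<bar>F n (u n + v n) - F n (u n) - ?G n \<bullet> v n\<bar>)"
      by (simp only: abs_minus_cancel sum_abs)
    also have "\<dots> \<le> (\<Sum>n = 1..T. c * ?N)"
      by (rule sum_mono) (rule bnd)
    also have "\<dots> = (real T * c) * ?N" by simp
    also have "\<dots> \<le> e * ?N"
    proof (rule mult_right_mono)
      show "real T * c \<le> e" using \<open>e > 0\<close> by (simp add: c_def field_simps)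
    qed (rule L2_set_nonneg)
    finally show "\<bar>F_fun T F (\<lambda>n. u n + v n) - F_fun T F u - F_fun_deriv T F u v\<bar> \<le> e * ?N" .
  qed
qed

definition eff_dom :: "nat \<Rightarrow> ((nat \<Rightarrow> 'a) \<Rightarrow> ereal) \<Rightarrow> (nat \<Rightarrow> 'a) set" where
  "eff_dom T f = {u \<in> X T. f u < \<infinity>}"

text \<open>Critical points, in the sense of Szulkin, of the energy
  \<open>(Psi T a \<Phi> + J T j) + F_fun T F\<close>, the sum of a convex and a $C^1$ functional.\<close>

definition critical_point ::
  "nat \<Rightarrow> real \<Rightarrow> ('a::real_inner \<Rightarrow> real) \<Rightarrow> ('a \<times> 'a \<Rightarrow> ereal) \<Rightarrow> (nat \<Rightarrow> 'a \<Rightarrow> real)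
    \<Rightarrow> (nat \<Rightarrow> 'a) \<Rightarrow> bool" where
  "critical_point T a \<Phi> j F w \<longleftrightarrow>
    (let PsiJ = (\<lambda>u. Psi T a \<Phi> u + J T j u) in
      w \<in> eff_dom T PsiJ \<and>
      (\<forall>v \<in> eff_dom T PsiJ. PsiJ v - PsiJ w + ereal (F_fun_deriv T F w (\<lambda>n. v n - w n)) \<ge> 0))"

definition is_solution ::
  "nat \<Rightarrow> real \<Rightarrow> ('a::real_inner \<Rightarrow> 'a) \<Rightarrow> ('a \<times> 'a \<Rightarrow> ereal) \<Rightarrow> (nat \<Rightarrow> 'a \<Rightarrow> real)
    \<Rightarrow> (nat \<Rightarrow> 'a) \<Rightarrow> bool" where
  "is_solution T a \<phi> j F u \<longleftrightarrow>
    u \<in> X T \<and> Delta_norm T u < a \<and> subdifferential j (u 0, u (T + 1)) \<noteq> {} \<and>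
    (\<forall>n \<in> {1..T}. - Delta (\<lambda>m. \<phi> (Delta u m)) (n - 1) = gradient (F n) (u n)) \<and>
    (\<phi> (Delta u 0), - \<phi> (Delta u T)) \<in> subdifferential j (u 0, u (T + 1))"

end

theory Submission
  imports Defs
begin

text \<open>
  Being a critical point is a variational inequality. Move from \<open>w\<close> to \<open>w + t(v - w)\<close> and bound
  the increment of \<open>\<Phi>\<close> by the gradient at the new point: if all differences of \<open>w + t(v - w)\<close> lie
  in the open ball, then convexity of \<open>j\<close> and division by \<open>t\<close> give,
  whenever \<open>j(v(0), v(T+1))\<close> is finite,
  $$j(w(0),w(T+1)) \le j(v(0),v(T+1)) + \sum_{n=0}^{T} \langle\phi(\Delta w(n) + t\,\Delta(v-w)(n))
     | \Delta(v-w)(n)\rangle - \sum_{n=1}^{T}\langle\nabla_u F(n,w(n))| v(n)-w(n)\rangle$$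
  (\<open>critical_point_variational_inequality\<close>). It is used twice.

  For \<open>v = 0\<close> the differences of \<open>w + t(v - w) = (1 - t)w\<close> are interior, so for all \<open>0 < t < 1\<close> the sum
  of the nonnegative numbers $\langle\phi((1-t)\Delta w(n))|\Delta w(n)\rangle$ is bounded by a constant.
  If $|\Delta w(n)| = a$ for some \<open>n\<close>, that term is unbounded as \<open>t\<close> tends to 0
  (\<open>monotone_homeomorphism_blowup\<close>), because a monotone homeomorphism \<open>\<phi>\<close> of the ball onto the whole
  space satisfies $\langle\phi(y)|y\rangle \ge \frac a2 |\phi(y)| - C$ and $|\phi(y)|\to\infty$ at the
  boundary. Hence \<open>Delta_norm T w < a\<close>.

  With interior differences every \<open>v\<close> with finite \<open>j(v(0), v(T+1))\<close> is admissible for small \<open>t\<close>, and \<open>t\<close> tending to 0 replaces the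
  argument of \<open>\<phi>\<close> by $\Delta w(n)$. Varying \<open>w\<close> at one interior index then yields the difference
  equation; varying it at the two end points yields the subgradient inequality for \<open>j\<close>.
\<close>

section \<open>Gradients of strictly convex functions\<close>

lemma strictly_convex_on_imp_above_gradient:
  fixes f :: "'a::real_inner \<Rightarrow> real"
  assumes conv: "strictly_convex_on S f" and "x \<in> S" "y \<in> S" and D: "GDERIV f x :> D"
  shows "f x + D \<bullet> (y - x) \<le> f y"
proof (cases "x = y")
  case False
  let ?q = "\<lambda>t. (f (x + t *\<^sub>R (y - x)) - f x) / t"
  have "(f has_derivative (\<lambda>h. h \<bullet> D)) (at (x + 0 *\<^sub>R (y - x)))"
    using D by (simp add: gderiv_def)
  moreover have "((\<lambda>t. x + t *\<^sub>R (y - x)) has_derivative (\<lambda>t. t *\<^sub>R (y - x))) (at (0::real))"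
    by (auto intro!: derivative_eq_intros)
  ultimately have "((\<lambda>t. f (x + t *\<^sub>R (y - x))) has_derivative (\<lambda>t. (t *\<^sub>R (y - x)) \<bullet> D)) (at 0)"
    by (rule has_derivative_compose[rotated])
  then have "((\<lambda>t. f (x + t *\<^sub>R (y - x))) has_field_derivative D \<bullet> (y - x)) (at 0)"
    by (rule has_derivative_imp_has_field_derivative) (simp add: inner_commute)
  then have "(?q \<longlongrightarrow> D \<bullet> (y - x)) (at 0)"
    by (simp add: DERIV_def)
  then have lim: "(?q \<longlongrightarrow> D \<bullet> (y - x)) (at_right 0)"
    by (rule tendsto_within_subset) simp
  have "?q t \<le> f y - f x" if "0 < t" "t < 1" for t
  proof -
    have "x + t *\<^sub>R (y - x) = (1 - t) *\<^sub>R x + t *\<^sub>R y"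
      by (simp add: algebra_simps)
    then have "f (x + t *\<^sub>R (y - x)) \<le> (1 - t) * f x + t * f y"
      using conv that False assms(2,3) unfolding strictly_convex_on_def by force
    then show ?thesis
      using that by (simp add: pos_divide_le_eq) (simp add: algebra_simps)
  qed
  moreover have "eventually (\<lambda>t::real. 0 < t \<and> t < 1) (at_right 0)"
    by (auto simp: eventually_at_right_field intro: exI[of _ 1])
  ultimately have "eventually (\<lambda>t. ?q t \<le> f y - f x) (at_right 0)"
    by (auto elim: eventually_mono)
  from tendsto_upperbound[OF lim this] show ?thesis by simp
qed simp

lemma gradient_of_strictly_convex_on_monotone:
  fixes f :: "'a::real_inner \<Rightarrow> real"
  assumes "strictly_convex_on S f" and "x \<in> S" "y \<in> S" and "GDERIV f x :> D" "GDERIV f y :> E"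
  shows "0 \<le> (E - D) \<bullet> (y - x)"
  using strictly_convex_on_imp_above_gradient[OF assms(1-4)]
    strictly_convex_on_imp_above_gradient[OF assms(1,3,2,5)]
  by (simp add: inner_diff_left inner_diff_right)

section \<open>The variational inequality of a critical point\<close>

lemma Delta_norm_le_iff: "Delta_norm T u \<le> a \<longleftrightarrow> (\<forall>n\<le>T. norm (Delta u n) \<le> a)"
proof -
  have "(\<forall>n\<in>{1..T + 1}. norm (Delta u (n - 1)) \<le> a) \<longleftrightarrow> (\<forall>n\<le>T. norm (Delta u n) \<le> a)"
    by (metis Suc_eq_plus1 Suc_le_mono Suc_pred' add_diff_cancel_right' atLeastAtMost_iff
        le_add2 less_eq_Suc_le One_nat_def)
  then show ?thesis
    by (simp add: Delta_norm_def)
qed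

lemma Delta_norm_less_iff: "Delta_norm T u < a \<longleftrightarrow> (\<forall>n\<le>T. norm (Delta u n) < a)"
proof -
  have "(\<forall>n\<in>{1..T + 1}. norm (Delta u (n - 1)) < a) \<longleftrightarrow> (\<forall>n\<le>T. norm (Delta u n) < a)"
    by (metis Suc_eq_plus1 Suc_le_mono Suc_pred' add_diff_cancel_right' atLeastAtMost_iff
        le_add2 less_eq_Suc_le One_nat_def)
  then show ?thesis
    by (simp add: Delta_norm_def)
qed

lemma Psi_eq_sum:
  "Psi T a \<Phi> u = (if \<forall>n\<le>T. norm (Delta u n) \<le> a then ereal (\<Sum>n\<le>T. \<Phi> (Delta u n)) else \<infinity>)"
  unfolding Psi_def Delta_norm_le_iff
  by (simp add: sum.atLeast1_atMost_eq lessThan_Suc_atMost del: sum.cl_ivl_Suc)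

lemma critical_pointD:
  assumes crit: "critical_point T a \<Phi> j F w" and proper: "proper_fun j"
  shows "w \<in> X T" and "n \<le> T \<Longrightarrow> norm (Delta w n) \<le> a" and "\<bar>j (w 0, w (T + 1))\<bar> \<noteq> \<infinity>"
proof -
  have dom: "w \<in> X T" "Psi T a \<Phi> w + j (w 0, w (T + 1)) < \<infinity>"
    using crit by (auto simp: critical_point_def Let_def eff_dom_def J_def)
  have ninf: "j (w 0, w (T + 1)) \<noteq> -\<infinity>"
    using proper by (auto simp: proper_fun_def)
  show "w \<in> X T" by (fact dom)
  show "n \<le> T \<Longrightarrow> norm (Delta w n) \<le> a"
    using dom(2) by (auto simp: Psi_eq_sum split: if_splits)
  show "\<bar>j (w 0, w (T + 1))\<bar> \<noteq> \<infinity>"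
    using dom(2) ninf by (auto simp: Psi_eq_sum split: if_splits)
qed

text \<open>Only the values of \<open>v\<close> on \<open>{0..T + 1}\<close> matter, so \<open>v\<close> need not lie in \<open>X T\<close>, and its
  differences may leave the ball as long as those of \<open>w + t(v - w)\<close> do not.\<close>

lemma critical_point_variational_inequality:
  fixes \<Phi> :: "'a::real_inner \<Rightarrow> real"
  assumes grad: "\<And>x. x \<in> ball 0 a \<Longrightarrow> GDERIV \<Phi> x :> \<phi> x"
    and sconv: "strictly_convex_on (cball 0 a) \<Phi>"
    and proper: "proper_fun j" and conv: "convex_fun j"
    and crit: "critical_point T a \<Phi> j F w"
    and jv: "j (v 0, v (T + 1)) < \<infinity>" and t: "0 < t" "t < 1"
    and int: "\<And>n. n \<le> T \<Longrightarrow> norm (Delta w n + t *\<^sub>R (Delta v n - Delta w n)) < a"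
  shows "real_of_ereal (j (w 0, w (T + 1))) \<le> real_of_ereal (j (v 0, v (T + 1)))
      + (\<Sum>n\<le>T. \<phi> (Delta w n + t *\<^sub>R (Delta v n - Delta w n)) \<bullet> (Delta v n - Delta w n))
      - (\<Sum>n = 1..T. gradient (F n) (w n) \<bullet> (v n - w n))"
proof -
  let ?d = "\<lambda>n. Delta v n - Delta w n" and ?y = "\<lambda>n. Delta w n + t *\<^sub>R (Delta v n - Delta w n)"
  let ?G = "\<Sum>n = 1..T. gradient (F n) (w n) \<bullet> (v n - w n)"
  define z where "z = restrict (\<lambda>n. w n + t *\<^sub>R (v n - w n)) {0..T + 1}"
  have Dz: "Delta z n = ?y n" if "n \<le> T" for n
    using that by (simp add: z_def Delta_def algebra_simps)
  obtain p where p: "j (w 0, w (T + 1)) = ereal p"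
    using critical_pointD(3)[OF crit proper] by auto
  obtain q where q: "j (v 0, v (T + 1)) = ereal q"
    using jv proper unfolding proper_fun_def by (metis ereal_cases less_irrefl)
  have "(z 0, z (T + 1)) = (1 - t) *\<^sub>R (w 0, w (T + 1)) + t *\<^sub>R (v 0, v (T + 1))"
    by (simp add: z_def algebra_simps)
  then have jz_le: "j (z 0, z (T + 1)) \<le> ereal ((1 - t) * p + t * q)"
    using conv t p q unfolding convex_fun_def by (metis plus_ereal.simps(1) times_ereal.simps(1))
  obtain r where r: "j (z 0, z (T + 1)) = ereal r" and r_le: "r \<le> (1 - t) * p + t * q"
    using jz_le proper unfolding proper_fun_def by (cases "j (z 0, z (T + 1))") auto
  have Psi_z: "Psi T a \<Phi> z = ereal (\<Sum>n\<le>T. \<Phi> (?y n))"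
    using int by (auto simp: Psi_eq_sum Dz less_imp_le)
  have Psi_w: "Psi T a \<Phi> w = ereal (\<Sum>n\<le>T. \<Phi> (Delta w n))"
    using critical_pointD(2)[OF crit proper] by (auto simp: Psi_eq_sum)
  have "z \<in> eff_dom T (\<lambda>u. Psi T a \<Phi> u + J T j u)"
    using Psi_z r by (simp add: eff_dom_def J_def X_def z_def)
  then have "0 \<le> (Psi T a \<Phi> z + J T j z) - (Psi T a \<Phi> w + J T j w)
      + ereal (F_fun_deriv T F w (\<lambda>n. z n - w n))"
    using crit by (simp add: critical_point_def Let_def)
  moreover have "F_fun_deriv T F w (\<lambda>n. z n - w n) = - t * ?G"
    by (simp add: F_fun_deriv_def z_def sum_distrib_left sum_negf)
  ultimately have main:
    "0 \<le> (\<Sum>n\<le>T. \<Phi> (?y n)) - (\<Sum>n\<le>T. \<Phi> (Delta w n)) + (r - p) - t * ?G"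
    using p r Psi_z Psi_w by (simp add: J_def zero_ereal_def)
  \<comment> \<open>The gradient is taken at the interior point \<open>?y n\<close>, since \<open>Delta w n\<close> may lie on the sphere.\<close>
  have "\<Phi> (?y n) - \<Phi> (Delta w n) \<le> t * (\<phi> (?y n) \<bullet> ?d n)" if "n \<le> T" for n
    using strictly_convex_on_imp_above_gradient[OF sconv, of "?y n" "Delta w n" "\<phi> (?y n)"]
      int[OF that] critical_pointD(2)[OF crit proper that] grad
    by (simp add: inner_diff_right)
  then have "(\<Sum>n\<le>T. \<Phi> (?y n)) - (\<Sum>n\<le>T. \<Phi> (Delta w n)) \<le> t * (\<Sum>n\<le>T. \<phi> (?y n) \<bullet> ?d n)"
    unfolding sum_subtractf[symmetric] sum_distrib_left by (intro sum_mono) auto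
  with main r_le have "0 \<le> t * ((\<Sum>n\<le>T. \<phi> (?y n) \<bullet> ?d n) + (q - p) - ?G)"
    by (simp add: algebra_simps)
  then show ?thesis
    using t p q by (simp add: zero_le_mult_iff)
qed

section \<open>Differences of a critical point are interior\<close>

text \<open>A monotone homeomorphism of the open ball onto the whole space blows up at the boundary, even
  in the radial direction. Monotonicity turns growth of \<open>norm (\<phi> y)\<close> into growth of \<open>\<phi> y \<bullet> y\<close>: compare
  \<open>y\<close> with the point of the sphere of radius \<open>a / 2\<close> in the direction of \<open>\<phi> y\<close> (when \<open>\<phi> y \<noteq> 0\<close>).\<close>

lemma monotone_homeomorphism_blowup:
  fixes \<phi> :: "'a::euclidean_space \<Rightarrow> 'a"
  assumes hom: "homeomorphism (ball 0 a) UNIV \<phi> g" and "a > 0"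
    and mono: "\<And>x y. x \<in> ball 0 a \<Longrightarrow> y \<in> ball 0 a \<Longrightarrow> 0 \<le> (\<phi> y - \<phi> x) \<bullet> (y - x)"
    and x: "norm x = a"
  shows "\<exists>t. 0 < t \<and> t < 1 \<and> C < \<phi> ((1 - t) *\<^sub>R x) \<bullet> x"
proof -
  have cont: "continuous_on (ball 0 a) \<phi>" "continuous_on UNIV g"
    and inv: "\<And>y. y \<in> ball 0 a \<Longrightarrow> g (\<phi> y) = y" and img: "range g = ball 0 a"
    using hom by (auto simp: homeomorphism_def)
  have "compact (\<phi> ` cball 0 (a / 2))"
    using \<open>a > 0\<close> by (intro compact_continuous_image continuous_on_subset[OF cont(1)]) auto
  then obtain M where "M > 0" and M: "\<And>y. y \<in> cball 0 (a / 2) \<Longrightarrow> norm (\<phi> y) \<le> M"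
    using bounded_pos[of "\<phi> ` cball 0 (a / 2)"] by (auto dest: compact_imp_bounded)
  have coercive: "a / 2 * norm (\<phi> y) - M * (2 * a) \<le> \<phi> y \<bullet> y" if y: "y \<in> ball 0 a" for y
  proof -
    define e where "e = (a / 2) *\<^sub>R sgn (\<phi> y)"
    have e: "norm e \<le> a / 2"
      using \<open>a > 0\<close> by (simp add: e_def norm_sgn)
    have "\<phi> y \<bullet> sgn (\<phi> y) = norm (\<phi> y)"
      by (cases "\<phi> y = 0") (simp_all add: sgn_div_norm dot_square_norm power2_eq_square)
    then have ey: "\<phi> y \<bullet> e = a / 2 * norm (\<phi> y)"
      by (simp add: e_def)
    have "norm (y - e) \<le> 2 * a"
      using norm_triangle_ineq4[of y e] e y \<open>a > 0\<close> by simp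
    then have "\<bar>\<phi> e \<bullet> (y - e)\<bar> \<le> M * (2 * a)"
      using Cauchy_Schwarz_ineq2[of "\<phi> e" "y - e"] M[of e] e \<open>M > 0\<close>
      by (smt (verit) mem_cball_0 mult_mono norm_ge_zero)
    moreover have "0 \<le> (\<phi> y - \<phi> e) \<bullet> (y - e)"
      using e y \<open>a > 0\<close> by (intro mono) auto
    ultimately show ?thesis
      using ey by (simp add: inner_diff_left inner_diff_right)
  qed
  \<comment> \<open>Where \<open>norm (\<phi> y) > K\<close>, coercivity forces \<open>\<phi> y \<bullet> y > \<bar>C\<bar>\<close>. The remaining points form the
    compact set \<open>g ` cball 0 K\<close>, which stays away from the sphere; \<open>y\<close> is taken beyond it.\<close>
  define K where "K = (\<bar>C\<bar> + 1 + M * (2 * a)) / (a / 2)"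
  have "compact (g ` cball 0 K)"
    by (intro compact_continuous_image continuous_on_subset[OF cont(2)]) auto
  moreover have "0 \<le> K"
    unfolding K_def using \<open>a > 0\<close> \<open>M > 0\<close>
    by (intro divide_nonneg_pos add_nonneg_nonneg mult_nonneg_nonneg) auto
  then have "g ` cball 0 K \<noteq> {}"
    by simp
  ultimately obtain y0 where y0: "y0 \<in> g ` cball 0 K" "\<And>y. y \<in> g ` cball 0 K \<Longrightarrow> norm y \<le> norm y0"
    using continuous_attains_sup[of "g ` cball 0 K" norm] by (auto intro: continuous_intros)
  have "norm y0 < a"
    using y0(1) img by auto
  define t where "t = (1 - norm y0 / a) / 2"
  have t: "0 < t" "t < 1"
    using \<open>norm y0 < a\<close> \<open>a > 0\<close> by (auto simp: t_def field_simps add_pos_nonneg)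
  define y where "y = (1 - t) *\<^sub>R x"
  have ny: "norm y = (a + norm y0) / 2"
    using t x \<open>a > 0\<close> by (simp add: y_def) (simp add: t_def field_simps)
  then have yb: "y \<in> ball 0 a" and "norm y0 < norm y"
    using \<open>norm y0 < a\<close> by auto
  then have "y \<notin> g ` cball 0 K"
    using y0(2) by fastforce
  then have "K < norm (\<phi> y)"
    using inv[OF yb] by (metis image_eqI mem_cball_0 not_le)
  then have "\<bar>C\<bar> + 1 + M * (2 * a) < a / 2 * norm (\<phi> y)"
    using \<open>a > 0\<close> by (simp add: K_def field_simps)
  with coercive[OF yb] have "\<bar>C\<bar> < \<phi> y \<bullet> y" by simp
  also have "\<phi> y \<bullet> y = (1 - t) * (\<phi> y \<bullet> x)" by (simp add: y_def)
  finally have less: "\<bar>C\<bar> < (1 - t) * (\<phi> y \<bullet> x)" .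
  then have "0 < \<phi> y \<bullet> x"
    using t by (smt (verit) zero_less_mult_pos abs_ge_zero)
  then have "(1 - t) * (\<phi> y \<bullet> x) \<le> \<phi> y \<bullet> x"
    using t by (simp add: mult_le_cancel_right1)
  then show ?thesis
    using less t by (intro exI[of _ t]) (auto simp: y_def)
qed

lemma critical_point_Delta_norm_less:
  fixes \<Phi> :: "'a::euclidean_space \<Rightarrow> real"
  assumes "a > 0"
    and hom: "homeomorphism (ball 0 a) UNIV \<phi> g" and phi0: "\<phi> 0 = 0"
    and grad: "\<And>x. x \<in> ball 0 a \<Longrightarrow> GDERIV \<Phi> x :> \<phi> x"
    and sconv: "strictly_convex_on (cball 0 a) \<Phi>"
    and proper: "proper_fun j" and conv: "convex_fun j" and j0: "j (0, 0) < \<infinity>"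
    and crit: "critical_point T a \<Phi> j F w"
  shows "Delta_norm T w < a"
proof (rule ccontr)
  assume "\<not> Delta_norm T w < a"
  then obtain m where m: "m \<le> T" "norm (Delta w m) = a"
    using critical_pointD(2)[OF crit proper] by (force simp: Delta_norm_less_iff)
  have mono: "0 \<le> (\<phi> y - \<phi> x) \<bullet> (y - x)" if "x \<in> ball 0 a" "y \<in> ball 0 a" for x y
    using gradient_of_strictly_convex_on_monotone[OF sconv _ _ grad[OF that(1)] grad[OF that(2)]] that
    by simp
  define C where "C = real_of_ereal (j (0, 0)) - real_of_ereal (j (w 0, w (T + 1)))
    + (\<Sum>n = 1..T. gradient (F n) (w n) \<bullet> w n)"
  obtain t where t: "0 < t" "t < 1" and big: "C < \<phi> ((1 - t) *\<^sub>R Delta w m) \<bullet> Delta w m"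
    using monotone_homeomorphism_blowup[OF hom \<open>a > 0\<close> mono m(2)] by blast
  have eq: "Delta w n + t *\<^sub>R (Delta (\<lambda>_. 0) n - Delta w n) = (1 - t) *\<^sub>R Delta w n" for n
    by (simp add: Delta_def algebra_simps)
  have int: "norm ((1 - t) *\<^sub>R Delta w n) < a" if "n \<le> T" for n
  proof -
    have "(1 - t) * norm (Delta w n) \<le> (1 - t) * a"
      using t critical_pointD(2)[OF crit proper that] by (intro mult_left_mono) auto
    also have "\<dots> < a" using t \<open>a > 0\<close> by simp
    finally show ?thesis using t by simp
  qed
  have "real_of_ereal (j (w 0, w (T + 1))) \<le> real_of_ereal (j (0, 0))
      + (\<Sum>n\<le>T. \<phi> ((1 - t) *\<^sub>R Delta w n) \<bullet> (Delta (\<lambda>_. 0) n - Delta w n))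
      - (\<Sum>n = 1..T. gradient (F n) (w n) \<bullet> (0 - w n))"
    using critical_point_variational_inequality[OF grad sconv proper conv crit, of "\<lambda>_. 0" t]
      t j0 int unfolding eq by simp
  then have "(\<Sum>n\<le>T. \<phi> ((1 - t) *\<^sub>R Delta w n) \<bullet> Delta w n) \<le> C"
    by (simp add: C_def Delta_def[of "\<lambda>_. 0"] sum_negf)
  moreover have "0 \<le> \<phi> ((1 - t) *\<^sub>R Delta w n) \<bullet> Delta w n" if "n \<le> T" for n
    using mono[of 0 "(1 - t) *\<^sub>R Delta w n"] int[OF that] t \<open>a > 0\<close>
    by (simp add: phi0 zero_le_mult_iff)
  then have "\<phi> ((1 - t) *\<^sub>R Delta w m) \<bullet> Delta w m \<le> (\<Sum>n\<le>T. \<phi> ((1 - t) *\<^sub>R Delta w n) \<bullet> Delta w n)"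
    using m(1) by (intro member_le_sum) auto
  ultimately show False using big by simp
qed

section \<open>First variation and the boundary value problem\<close>

text \<open>The limit \<open>t\<close> to 0 of the variational inequality, available once the differences of \<open>w\<close> are
  interior. Neither \<open>v\<close> nor its differences are restricted beyond the domain of \<open>j\<close>.\<close>

lemma critical_point_first_variation:
  fixes \<Phi> :: "'a::real_inner \<Rightarrow> real"
  assumes grad: "\<And>x. x \<in> ball 0 a \<Longrightarrow> GDERIV \<Phi> x :> \<phi> x"
    and cont: "continuous_on (ball 0 a) \<phi>"
    and sconv: "strictly_convex_on (cball 0 a) \<Phi>"
    and proper: "proper_fun j" and conv: "convex_fun j"
    and crit: "critical_point T a \<Phi> j F w" and int: "Delta_norm T w < a"
    and jv: "j (v 0, v (T + 1)) < \<infinity>"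
  shows "real_of_ereal (j (w 0, w (T + 1))) \<le> real_of_ereal (j (v 0, v (T + 1)))
      + (\<Sum>n\<le>T. \<phi> (Delta w n) \<bullet> (Delta v n - Delta w n))
      - (\<Sum>n = 1..T. gradient (F n) (w n) \<bullet> (v n - w n))"
proof -
  let ?y = "\<lambda>n t. Delta w n + t *\<^sub>R (Delta v n - Delta w n)"
  have y: "(?y n \<longlongrightarrow> Delta w n) (at_right 0)" for n
    by (auto intro!: tendsto_eq_intros)
  have ball: "Delta w n \<in> ball 0 a" if "n \<le> T" for n
    using int that by (simp add: Delta_norm_less_iff)
  have lim: "((\<lambda>t. \<phi> (?y n t)) \<longlongrightarrow> \<phi> (Delta w n)) (at_right 0)" if "n \<le> T" for n
    using cont ball[OF that] by (intro isCont_tendsto_compose[OF _ y])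
      (simp add: continuous_on_eq_continuous_at)
  have "eventually (\<lambda>t. \<forall>n\<in>{..T}. ?y n t \<in> ball 0 a) (at_right 0)"
    using topological_tendstoD[OF y open_ball ball] by (intro eventually_ball_finite) auto
  moreover have "eventually (\<lambda>t::real. 0 < t \<and> t < 1) (at_right 0)"
    by (auto simp: eventually_at_right_field intro: exI[of _ 1])
  ultimately have ev: "eventually (\<lambda>t. real_of_ereal (j (w 0, w (T + 1)))
      \<le> real_of_ereal (j (v 0, v (T + 1)))
        + (\<Sum>n\<le>T. \<phi> (?y n t) \<bullet> (Delta v n - Delta w n))
        - (\<Sum>n = 1..T. gradient (F n) (w n) \<bullet> (v n - w n))) (at_right 0)"
  proof eventually_elim
    case (elim t)
    show ?case
      by (rule critical_point_variational_inequality[where \<Phi> = \<Phi> and a = a])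
        (use elim grad sconv proper conv crit jv in auto)
  qed
  show ?thesis
    by (rule tendsto_lowerbound[OF _ ev]) (auto intro!: tendsto_intros lim)
qed

theorem theorem4p1:
  fixes T :: nat and a :: real
    and \<phi> :: "real ^ 'n \<Rightarrow> real ^ 'n" and \<Phi> :: "real ^ 'n \<Rightarrow> real"
    and F :: "nat \<Rightarrow> real ^ 'n \<Rightarrow> real"
    and j :: "(real ^ 'n) \<times> (real ^ 'n) \<Rightarrow> ereal"
    and w :: "nat \<Rightarrow> real ^ 'n"
  assumes "T \<ge> 2" and "a > 0"
    and "\<exists>g. homeomorphism (ball 0 a) UNIV \<phi> g" and "\<phi> 0 = 0"
    and "\<forall>x \<in> ball 0 a. \<phi> x = gradient \<Phi> x"
    and "C1_on (ball 0 a) \<Phi>"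
    and "continuous_on (cball 0 a) \<Phi>" and "strictly_convex_on (cball 0 a) \<Phi>"
    and "\<Phi> 0 = 0"
    and "continuous_on ({1..T} \<times> UNIV) (\<lambda>(n, x). F n x)"
    and "\<forall>n \<in> {1..T}. \<forall>x. \<exists>D. GDERIV (F n) x :> D"
    and "continuous_on ({1..T} \<times> UNIV) (\<lambda>(n, x). gradient (F n) x)"
    and "\<forall>n \<in> {1..T}. F n 0 = 0"
    and "proper_fun j" and "convex_fun j" and "lsc_fun j"
    and "j (0, 0) = 0" and "(0, 0) \<in> subdifferential j (0, 0)"
    and "critical_point T a \<Phi> j F w"
  shows "is_solution T a \<phi> j F w"
proof -
  note proper = \<open>proper_fun j\<close> and crit = \<open>critical_point T a \<Phi> j F w\<close>
  obtain g where hom: "homeomorphism (ball 0 a) UNIV \<phi> g"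
    using assms(3) by blast
  then have cont: "continuous_on (ball 0 a) \<phi>"
    by (simp add: homeomorphism_def)
  have grad: "GDERIV \<Phi> x :> \<phi> x" if "x \<in> ball 0 a" for x
    using assms(5,6) that unfolding C1_on_def by (metis gradient_eqI)
  have int: "Delta_norm T w < a"
    using critical_point_Delta_norm_less[OF \<open>a > 0\<close> hom \<open>\<phi> 0 = 0\<close> grad assms(8) proper
        assms(15) _ crit] \<open>j (0, 0) = 0\<close> by simp
  note variation = critical_point_first_variation[OF grad cont assms(8) proper assms(15) crit int]
  obtain p where p: "j (w 0, w (T + 1)) = ereal p"
    using critical_pointD(3)[OF crit proper] by auto

  \<comment> \<open>A variation at the single index \<open>n\<close> leaves the end points, hence \<open>j\<close>, unchanged.\<close>
  have eqn: "- Delta (\<lambda>m. \<phi> (Delta w m)) (n - 1) = gradient (F n) (w n)" if n: "n \<in> {1..T}" for n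
  proof -
    define R where "R = \<phi> (Delta w (n - 1)) - \<phi> (Delta w n) - gradient (F n) (w n)"
    have nonneg: "0 \<le> R \<bullet> h" for h
    proof -
      define v where "v = w(n := w n + h)"
      have "Delta v k - Delta w k = (if k = n - 1 then h else 0) - (if k = n then h else 0)" for k
        using n by (auto simp: v_def Delta_def)
      then have "(\<Sum>k\<le>T. \<phi> (Delta w k) \<bullet> (Delta v k - Delta w k))
          = (\<Sum>k\<le>T. (if k = n - 1 then \<phi> (Delta w k) \<bullet> h else 0)
                    - (if k = n then \<phi> (Delta w k) \<bullet> h else 0))"
        by (intro sum.cong) (auto simp: inner_diff_right)
      also have "\<dots> = \<phi> (Delta w (n - 1)) \<bullet> h - \<phi> (Delta w n) \<bullet> h"
        using n by (auto simp: sum_subtractf)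
      finally have "(\<Sum>k\<le>T. \<phi> (Delta w k) \<bullet> (Delta v k - Delta w k))
          = \<phi> (Delta w (n - 1)) \<bullet> h - \<phi> (Delta w n) \<bullet> h" .
      moreover have "(\<Sum>k = 1..T. gradient (F k) (w k) \<bullet> (v k - w k))
          = (\<Sum>k = 1..T. if k = n then gradient (F k) (w k) \<bullet> h else 0)"
        by (intro sum.cong) (auto simp: v_def)
      then have "(\<Sum>k = 1..T. gradient (F k) (w k) \<bullet> (v k - w k)) = gradient (F n) (w n) \<bullet> h"
        using n by simp
      moreover have "v 0 = w 0" "v (T + 1) = w (T + 1)"
        using n by (auto simp: v_def)
      ultimately show ?thesis
        using variation[of v] p by (simp add: R_def inner_diff_left)
    qed
    from nonneg[of "- R"] have "R = 0"
      by (metis inner_eq_zero_iff inner_ge_zero inner_minus_right neg_0_le_iff_le order_antisym)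
    then show ?thesis
      using n by (simp add: R_def Delta_def[of "\<lambda>m. \<phi> (Delta w m)"] algebra_simps)
  qed

  \<comment> \<open>A variation of the end points alone makes the sum over \<open>F\<close> vanish.\<close>
  have "j (w 0, w (T + 1))
      + ereal ((\<phi> (Delta w 0), - \<phi> (Delta w T)) \<bullet> (z - (w 0, w (T + 1)))) \<le> j z" for z
  proof (cases "j z < \<infinity>")
    case True
    then obtain r where r: "j z = ereal r"
      using proper unfolding proper_fun_def by (metis ereal_cases less_irrefl)
    define v where "v = w(0 := fst z, T + 1 := snd z)"
    let ?h = "fst z - w 0" and ?k = "snd z - w (T + 1)"
    have ends: "v 0 = fst z" "v (T + 1) = snd z"
      by (auto simp: v_def)
    have "Delta v k - Delta w k = (if k = T then ?k else 0) - (if k = 0 then ?h else 0)"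
      if "k \<le> T" for k
      using that \<open>T \<ge> 2\<close> by (auto simp: v_def Delta_def)
    then have "(\<Sum>k\<le>T. \<phi> (Delta w k) \<bullet> (Delta v k - Delta w k))
        = (\<Sum>k\<le>T. (if k = T then \<phi> (Delta w k) \<bullet> ?k else 0)
                  - (if k = 0 then \<phi> (Delta w k) \<bullet> ?h else 0))"
      by (intro sum.cong) (auto simp: inner_diff_right)
    also have "\<dots> = \<phi> (Delta w T) \<bullet> ?k - \<phi> (Delta w 0) \<bullet> ?h"
      unfolding sum_subtractf by simp
    finally have "(\<Sum>k\<le>T. \<phi> (Delta w k) \<bullet> (Delta v k - Delta w k))
        = \<phi> (Delta w T) \<bullet> ?k - \<phi> (Delta w 0) \<bullet> ?h" .
    moreover have "(\<Sum>k = 1..T. gradient (F k) (w k) \<bullet> (v k - w k)) = 0"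
      by (intro sum.neutral) (auto simp: v_def)
    ultimately have "p \<le> r + (\<phi> (Delta w T) \<bullet> ?k - \<phi> (Delta w 0) \<bullet> ?h)"
      using variation[of v] True p r unfolding ends by simp
    then show ?thesis
      unfolding p r by (simp add: inner_prod_def)
  qed simp
  then have "(\<phi> (Delta w 0), - \<phi> (Delta w T)) \<in> subdifferential j (w 0, w (T + 1))"
    unfolding subdifferential_def by blast
  with eqn int critical_pointD(1)[OF crit proper] show ?thesis
    by (auto simp: is_solution_def)
qed

end
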